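(* Let $(X,\mathcal S(X),\mu,T)$ be a finite measure-preserving dynamical system and let $d$ be a $\mu$-compatible metric on $X$. Then $T$ is pairwise sensitive with respect to $d$ if and only if it is W-measurably sensitive with respect to $d$.
   Context: A finite measure-preserving dynamical system is $(X,\mathcal S(X),\mu,T)$ where $(X,\mathcal S(X))$ is a standard Borel space, $\mu$ is a nonatomic measure on $\mathcal S(X)$ with $0<\mu(X)<\infty$, and $T:X\to X$ is measurable with $\mu(T^{-1}(A))=\mu(A)$ for all $A\in\mathcal S(X)$. All metrics $d:X\times X\to\mathbb R$ are assumed Borel measurable and bounded by $1$. Such a metric $d$ is $\mu$-compatible if every ball $\{y: d(x,y)<\varepsilon\}$ ($x\in X$, $\varepsilon>0$) has positive $\mu$-measure. $T$ is pairwise sensitive with respect to $d$ if there is $\delta>0$ such that for $\mu\otimes\mu$-almost every $(x,y)\in X\times X$ there is $n\ge0$ with $d(T^nx,T^ny)\ge\delta$. $T$ is W-measurably sensitive with respect to $d$ if there is $\delta>0$ such that for every $x\in X$, $\limsup_{n\to\infty} d(T^nx,T^ny)>\delta$ for $\mu$-almost every $y\in X$. *)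

theory Defs
  imports "HOL-Analysis.Analysis"
begin

text \<open>The Polish topology is existentially quantified, on the carrier \<open>space M\<close>, which may be a proper
  subset of the type; only the Borel structure is retained.\<close>

definition standard_borel_space :: "'a measure \<Rightarrow> bool" where
  "standard_borel_space M \<longleftrightarrow>
     (\<exists>U :: 'a topology. topspace U = space M \<and> completely_metrizable_space U \<and> separable_space U \<and>
        sets M = sigma_sets (space M) {A. openin U A})"

definition nonatomic :: "'a measure \<Rightarrow> bool" where
  "nonatomic M \<longleftrightarrow>
     (\<forall>A\<in>sets M. 0 < emeasure M A \<longrightarrow>
        (\<exists>B\<in>sets M. B \<subseteq> A \<and> 0 < emeasure M B \<and> emeasure M B < emeasure M A))"

locale finite_mp_system = finite_measure M for M :: "'a measure" +
  fixes T :: "'a \<Rightarrow> 'a"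
  assumes standard_borel: "standard_borel_space M"
    and nonatomic: "nonatomic M"
    and positive_total: "0 < emeasure M (space M)"
    and measurable_T: "T \<in> measurable M M"
    and preserves_measure: "\<And>A. A \<in> sets M \<Longrightarrow> emeasure M (T -` A \<inter> space M) = emeasure M A"

text \<open>The locale \<^locale>\<open>Metric_space\<close> asks for nonnegativity and symmetry of \<open>d\<close> also outside the
  carrier. This is no restriction: every metric on the carrier extends by 0, and everything below
  depends only on the values of \<open>d\<close> on the carrier.\<close>

definition bounded_borel_metric :: "'a measure \<Rightarrow> ('a \<Rightarrow> 'a \<Rightarrow> real) \<Rightarrow> bool" where
  "bounded_borel_metric M d \<longleftrightarrow>
     Metric_space (space M) d \<and>
     (\<lambda>(x, y). d x y) \<in> borel_measurable (M \<Otimes>\<^sub>M M) \<and>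
     (\<forall>x\<in>space M. \<forall>y\<in>space M. d x y \<le> 1)"

definition compatible_metric :: "'a measure \<Rightarrow> ('a \<Rightarrow> 'a \<Rightarrow> real) \<Rightarrow> bool" where
  "compatible_metric M d \<longleftrightarrow>
     bounded_borel_metric M d \<and>
     (\<forall>x\<in>space M. \<forall>\<epsilon>>0. 0 < emeasure M {y \<in> space M. d x y < \<epsilon>})"

definition pairwise_sensitive :: "'a measure \<Rightarrow> ('a \<Rightarrow> 'a) \<Rightarrow> ('a \<Rightarrow> 'a \<Rightarrow> real) \<Rightarrow> bool" where
  "pairwise_sensitive M T d \<longleftrightarrow>
     (\<exists>\<delta>>0. AE (x, y) in M \<Otimes>\<^sub>M M. \<exists>n. d ((T ^^ n) x) ((T ^^ n) y) \<ge> \<delta>)"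

text \<open>The limsup is taken in \<^typ>\<open>ereal\<close>, where \<^const>\<open>limsup\<close> is total; for a bounded metric this
  is the real limsup.\<close>

definition W_measurably_sensitive :: "'a measure \<Rightarrow> ('a \<Rightarrow> 'a) \<Rightarrow> ('a \<Rightarrow> 'a \<Rightarrow> real) \<Rightarrow> bool" where
  "W_measurably_sensitive M T d \<longleftrightarrow>
     (\<exists>\<delta>::real. \<delta> > 0 \<and> (\<forall>x\<in>space M. AE y in M.
        limsup (\<lambda>n. ereal (d ((T ^^ n) x) ((T ^^ n) y))) > ereal \<delta>))"

end

(* If pairwise sensitivity holds with constant \<delta> but d(T^n x, T^n y) < \<delta>/2 for all n \<ge> N on a set of
   positively many y, then by invariance the w with d(T^n (T^N x), T^n w) < \<delta>/2 for all n \<ge> 0 form a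
   set of positive measure. By the triangle inequality no two of its points ever separate by \<delta>.
   The converse is Fubini. *)
theory Submission
  imports Defs
begin

context finite_mp_system
begin

lemma measurable_funpow_T [measurable]: "(T ^^ n) \<in> measurable M M"
  using measurable_compose_n[OF measurable_T] by simp

text \<open>Invariance makes \<open>M\<close> its own pushforward under \<open>T\<close>, so
  preimages of null sets are null.\<close>

lemma AE_T:
  assumes "AE x in M. P x"
  shows "AE x in M. P (T x)"
proof -
  have "distr M M T = M"
    by (rule measure_eqI) (simp_all add: emeasure_distr measurable_T preserves_measure)
  then show ?thesis
    using assms by (intro AE_distrD[OF measurable_T]) (simp only:)
qed

lemma AE_funpow_T:
  assumes "AE x in M. P x"
  shows "AE x in M. P ((T ^^ n) x)"
  using assms
\<comment> \<open>The next iterate is \<open>T ((T ^^ n) x)\<close>, so the induction hypothesis is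
  applied to \<open>\<lambda>x. P (T x)\<close>.\<close>
proof (induction n arbitrary: P)
  case (Suc n)
  from Suc.IH[OF AE_T[OF Suc.prems]] show ?case
    by simp
qed simp

lemma funpow_T_space: "x \<in> space M \<Longrightarrow> (T ^^ n) x \<in> space M"
  using measurable_space[OF measurable_funpow_T] .

text \<open>Two points whose orbits stay within \<delta>/2 of the orbit of \<open>x\<close> never
  get \<delta> apart, so such points can fill only a null set. Having this for every
  \<open>x\<close>, not just almost every one, allows iterates of a given point as base
  points.\<close>

lemma pairwise_sensitive_AE_separate:
  assumes d: "bounded_borel_metric M d"
    and sens: "AE (x, y) in M \<Otimes>\<^sub>M M. \<exists>n. d ((T ^^ n) x) ((T ^^ n) y) \<ge> \<delta>"
    and x: "x \<in> space M"
  shows "AE y in M. \<exists>n. d ((T ^^ n) x) ((T ^^ n) y) \<ge> \<delta> / 2"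
proof -
  interpret Metric_space "space M" d
    using d by (simp add: bounded_borel_metric_def)
  interpret P: pair_sigma_finite M M ..
  have pairs: "AE y in M. AE z in M. \<exists>n. d ((T ^^ n) y) ((T ^^ n) z) \<ge> \<delta>"
    using P.AE_pair[OF sens] by simp
  define close where "close y \<longleftrightarrow> (\<forall>n. d ((T ^^ n) x) ((T ^^ n) y) < \<delta> / 2)" for y
  have close_pair: "d ((T ^^ n) y) ((T ^^ n) z) < \<delta>"
    if "y \<in> space M" "z \<in> space M" "close y" "close z" for y z n
  proof -
    have "d ((T ^^ n) y) ((T ^^ n) z) \<le> d ((T ^^ n) x) ((T ^^ n) y) + d ((T ^^ n) x) ((T ^^ n) z)"
      using triangle'' that x by (simp add: funpow_T_space)
    also have "\<dots> < \<delta> / 2 + \<delta> / 2"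
      using that by (intro add_strict_mono) (auto simp: close_def)
    finally show ?thesis
      by simp
  qed
  have "AE z in M. \<not> close z"
  \<comment> \<open>Call \<open>y\<close> typical if almost every \<open>z\<close> separates from it
    by \<delta>; by \<open>pairs\<close>, almost every \<open>y\<close> is. If some close
    \<open>y\<close> is typical, all close points lie in its null set of exceptions; otherwise all
    close points are atypical, hence null.\<close>
  proof (cases "\<exists>y\<in>space M. close y \<and> (AE z in M. \<exists>n. d ((T ^^ n) y) ((T ^^ n) z) \<ge> \<delta>)")
    case True
    then obtain y where y: "y \<in> space M" "close y"
      and sep: "AE z in M. \<exists>n. d ((T ^^ n) y) ((T ^^ n) z) \<ge> \<delta>"
      by blast
    from sep AE_space show ?thesis
    proof eventually_elim
      case (elim z)
      then show ?case
        using close_pair[OF y(1) _ y(2)] by (meson not_less)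
    qed
  next
    case False
    from pairs AE_space show ?thesis
      by eventually_elim (use False in blast)
  qed
  then show ?thesis
    by (simp add: close_def not_less)
qed

lemma pairwise_sensitive_imp_W_measurably_sensitive:
  assumes d: "bounded_borel_metric M d"
    and sens: "pairwise_sensitive M T d"
  shows "W_measurably_sensitive M T d"
proof -
  from sens obtain \<delta> where \<delta>: "\<delta> > 0"
    and pairs: "AE (x, y) in M \<Otimes>\<^sub>M M. \<exists>n. d ((T ^^ n) x) ((T ^^ n) y) \<ge> \<delta>"
    unfolding pairwise_sensitive_def by blast
  \<comment> \<open>Distances of at least \<delta>/2 will recur at arbitrarily late times;
    \<delta>/4 leaves room for the strict inequality.\<close>
  have "AE y in M. limsup (\<lambda>n. ereal (d ((T ^^ n) x) ((T ^^ n) y))) > ereal (\<delta> / 4)"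
    if x: "x \<in> space M" for x
  proof -
    \<comment> \<open>Separation from the base point \<open>(T ^^ N) x\<close>, pulled back along
      \<open>T ^^ N\<close>, happens at the time \<open>n + N\<close>, hence not before
      \<open>N\<close>.\<close>
    have "AE y in M. \<exists>n. d ((T ^^ n) ((T ^^ N) x)) ((T ^^ n) ((T ^^ N) y)) \<ge> \<delta> / 2" for N
      using AE_funpow_T[OF pairwise_sensitive_AE_separate[OF d pairs funpow_T_space[OF x]]] .
    then have "AE y in M. \<forall>N. \<exists>n. d ((T ^^ (n + N)) x) ((T ^^ (n + N)) y) \<ge> \<delta> / 2"
      by (simp add: AE_all_countable funpow_add)
    then show ?thesis
    proof eventually_elim
      case (elim y)
      show ?case
      proof (rule ccontr)
        assume "\<not> ?thesis"
        then have "limsup (\<lambda>n. ereal (d ((T ^^ n) x) ((T ^^ n) y))) \<le> ereal (\<delta> / 4)"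
          by simp
        also have "\<dots> < ereal (\<delta> / 2)"
          using \<delta> by simp
        finally have "\<forall>\<^sub>F n in sequentially. ereal (d ((T ^^ n) x) ((T ^^ n) y)) < ereal (\<delta> / 2)"
          by (rule Limsup_lessD)
        then obtain N where "\<And>n. n \<ge> N \<Longrightarrow> d ((T ^^ n) x) ((T ^^ n) y) < \<delta> / 2"
          by (auto simp: eventually_sequentially)
        with elim show False
          by (meson le_add2 not_less)
      qed
    qed
  qed
  with \<delta> show ?thesis
    unfolding W_measurably_sensitive_def by (intro exI[of _ "\<delta> / 4"]) simp
qed

lemma W_measurably_sensitive_imp_pairwise_sensitive:
  assumes d: "bounded_borel_metric M d"
    and sens: "W_measurably_sensitive M T d"
  shows "pairwise_sensitive M T d"
proof -
  interpret P: pair_sigma_finite M M ..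
  from d have [measurable]: "(\<lambda>(x, y). d x y) \<in> borel_measurable (M \<Otimes>\<^sub>M M)"
    by (simp add: bounded_borel_metric_def)
  from sens obtain \<delta> :: real where \<delta>: "\<delta> > 0"
    and W: "\<And>x. x \<in> space M \<Longrightarrow>
      AE y in M. limsup (\<lambda>n. ereal (d ((T ^^ n) x) ((T ^^ n) y))) > ereal \<delta>"
    unfolding W_measurably_sensitive_def by blast
  \<comment> \<open>The same \<delta> serves: if all distances were below \<delta>, the limsup would
    be at most \<delta>.\<close>
  have "AE y in M. \<exists>n. d ((T ^^ n) x) ((T ^^ n) y) \<ge> \<delta>" if x: "x \<in> space M" for x
    using W[OF x]
  proof eventually_elim
    case (elim y)
    show ?case
    proof (rule ccontr)
      assume "\<not> ?thesis"
      then have "limsup (\<lambda>n. ereal (d ((T ^^ n) x) ((T ^^ n) y))) \<le> ereal \<delta>"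
        by (intro Limsup_bounded always_eventually) (simp add: not_le less_imp_le)
      with elim show False
        by simp
    qed
  qed
  then have "AE x in M. AE y in M. \<exists>n. d ((T ^^ n) x) ((T ^^ n) y) \<ge> \<delta>"
    by (rule AE_I2)
  \<comment> \<open>Passing from sections to the product measure uses that the set of separated
    pairs is measurable, as a countable union over \<open>n\<close>.\<close>
  moreover have "(\<lambda>p. d ((T ^^ n) (fst p)) ((T ^^ n) (snd p))) \<in> borel_measurable (M \<Otimes>\<^sub>M M)" for n
    using measurable_compose[of "\<lambda>p. ((T ^^ n) (fst p), (T ^^ n) (snd p))" "M \<Otimes>\<^sub>M M" "M \<Otimes>\<^sub>M M"
        "\<lambda>(x, y). d x y" borel] by simp
  then have "{p \<in> space (M \<Otimes>\<^sub>M M). \<exists>n. d ((T ^^ n) (fst p)) ((T ^^ n) (snd p)) \<ge> \<delta>}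
      \<in> sets (M \<Otimes>\<^sub>M M)"
    by measurable
  ultimately have "AE p in M \<Otimes>\<^sub>M M. \<exists>n. d ((T ^^ n) (fst p)) ((T ^^ n) (snd p)) \<ge> \<delta>"
    by (intro P.AE_pair_measure) simp_all
  with \<delta> show ?thesis
    unfolding pairwise_sensitive_def by (intro exI[of _ \<delta>]) (simp add: case_prod_beta)
qed

end

theorem propositionA1:
  fixes M :: "'a measure" and T :: "'a \<Rightarrow> 'a" and d :: "'a \<Rightarrow> 'a \<Rightarrow> real"
  assumes "finite_mp_system M T"
    and "compatible_metric M d"
  shows "pairwise_sensitive M T d \<longleftrightarrow> W_measurably_sensitive M T d"
proof -
  interpret finite_mp_system M T
    by fact
  have "bounded_borel_metric M d"
    using assms(2) by (simp add: compatible_metric_def)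
  then show ?thesis
    using pairwise_sensitive_imp_W_measurably_sensitive
      W_measurably_sensitive_imp_pairwise_sensitive by blast
qed

end
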